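(* Product measures for s-finite measures need not be unique: there exist measurable spaces $X,Y$ and s-finite measures $\mu$ on $X$ and $\nu$ on $Y$ that have more than one product measure on $X\times Y$. In particular, there exist s-finite measures $\mu$ and $\nu$ such that $\mu\otimes^l\nu\neq\mu\boxtimes\nu$.
   Context: A measure is s-finite if it is a countable sum of finite measures. Convention: $\infty\cdot0=0$. For measures $\mu$ on $X$ and $\nu$ on $Y$, a product measure of $\mu$ and $\nu$ is a measure $\Psi$ on $X\times Y$ (with the product $\sigma$-algebra) such that $\Psi(U\times V)=\mu(U)\nu(V)$ for all $U\in\Sigma_X$, $V\in\Sigma_Y$. The maximal product measure is $$(\mu\boxtimes\nu)(W):=\inf\Big\{\sum_{i\in\mathbb{N}}\mu(U_i)\nu(V_i)\;\Big|\;W\subseteq\bigcup_{i\in\mathbb{N}}(U_i\times V_i),\ U_i\in\Sigma_X,\ V_i\in\Sigma_Y\Big\},$$ which is always a product measure. The iterated-integral product measure (a well-defined product measure when $\mu,\nu$ are s-finite) is $$(\mu\otimes^l\nu)(W):=\int_X\mu(\mathrm{d}x)\int_Y\nu(\mathrm{d}y)\,\chi_W(x,y),$$ where $\chi_W$ is the characteristic function of $W$. *)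

theory Defs
  imports "HOL-Analysis.Analysis"
begin

section \<open>s-finite measures and product measures\<close>

definition s_finite_measure :: "'a measure \<Rightarrow> bool" where
  "s_finite_measure M \<longleftrightarrow>
     (\<exists>F :: nat \<Rightarrow> 'a measure.
        (\<forall>i. sets (F i) = sets M \<and> finite_measure (F i)) \<and>
        (\<forall>A\<in>sets M. emeasure M A = (\<Sum>i. emeasure (F i) A)))"

text \<open>On \<^typ>\<open>ennreal\<close> the library has \<open>\<infinity> * 0 = 0\<close>.\<close>

definition is_product_measure :: "'a measure \<Rightarrow> 'b measure \<Rightarrow> ('a \<times> 'b) measure \<Rightarrow> bool" where
  "is_product_measure M N P \<longleftrightarrow>
     sets P = sets (M \<Otimes>\<^sub>M N) \<and>
     (\<forall>U\<in>sets M. \<forall>V\<in>sets N. emeasure P (U \<times> V) = emeasure M U * emeasure N V)"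

definition rectangle_covers ::
    "'a measure \<Rightarrow> 'b measure \<Rightarrow> ('a \<times> 'b) set \<Rightarrow> ((nat \<Rightarrow> 'a set) \<times> (nat \<Rightarrow> 'b set)) set" where
  "rectangle_covers M N W =
     {(U, V). range U \<subseteq> sets M \<and> range V \<subseteq> sets N \<and> W \<subseteq> (\<Union>i. U i \<times> V i)}"

definition rectangle_outer :: "'a measure \<Rightarrow> 'b measure \<Rightarrow> ('a \<times> 'b) set \<Rightarrow> ennreal" where
  "rectangle_outer M N W =
     (INF (U, V)\<in>rectangle_covers M N W. \<Sum>i. emeasure M (U i) * emeasure N (V i))"

text \<open>
  \<^const>\<open>measure_of\<close> would return the null measure if the given set function were not a measure
  on the generated \<open>\<sigma>\<close>-algebra. The lemmas \<open>emeasure_maximal_product\<close> and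
  \<open>emeasure_pair_measure_s_finite\<close> below show that this does not happen for the maximal product,
  nor, for s-finite measures, for the iterated-integral product, which is the library's
  \<^const>\<open>pair_measure\<close>.
\<close>

definition maximal_product :: "'a measure \<Rightarrow> 'b measure \<Rightarrow> ('a \<times> 'b) measure" (infixr \<open>\<boxtimes>\<^sub>M\<close> 80) where
  "M \<boxtimes>\<^sub>M N = measure_of (space M \<times> space N)
     {a \<times> b | a b. a \<in> sets M \<and> b \<in> sets N} (rectangle_outer M N)"

abbreviation iterated_product :: "'a measure \<Rightarrow> 'b measure \<Rightarrow> ('a \<times> 'b) measure" (infixr \<open>\<otimes>\<^sup>l\<close> 80) where
  "M \<otimes>\<^sup>l N \<equiv> M \<Otimes>\<^sub>M N"


section \<open>The maximal product is a product measure\<close>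

lemma sets_maximal_product: "sets (M \<boxtimes>\<^sub>M N) = sets (M \<Otimes>\<^sub>M N)"
  unfolding maximal_product_def sets_pair_measure
  by (rule sets_measure_of[OF pair_measure_closed])

lemma rectangle_outer_le:
  assumes "range U \<subseteq> sets M" "range V \<subseteq> sets N" "W \<subseteq> (\<Union>i. U i \<times> V i)"
  shows "rectangle_outer M N W \<le> (\<Sum>i. emeasure M (U i) * emeasure N (V i))"
  unfolding rectangle_outer_def rectangle_covers_def
  by (rule INF_lower2[where i = "(U, V)"]) (use assms in auto)

lemma rectangle_outer_greatest:
  assumes "\<And>U V. range U \<subseteq> sets M \<Longrightarrow> range V \<subseteq> sets N \<Longrightarrow> W \<subseteq> (\<Union>i. U i \<times> V i) \<Longrightarrow>
      c \<le> (\<Sum>i. emeasure M (U i) * emeasure N (V i))"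
  shows "c \<le> rectangle_outer M N W"
  unfolding rectangle_outer_def rectangle_covers_def
  by (rule INF_greatest) (use assms in auto)

lemma rectangle_outer_less:
  assumes "rectangle_outer M N W < e"
  obtains U V where "range U \<subseteq> sets M" "range V \<subseteq> sets N" "W \<subseteq> (\<Union>i. U i \<times> V i)"
    "(\<Sum>i. emeasure M (U i) * emeasure N (V i)) < e"
  using assms unfolding rectangle_outer_def rectangle_covers_def INF_less_iff by auto

lemma rectangle_outer_mono: "W \<subseteq> W' \<Longrightarrow> rectangle_outer M N W \<le> rectangle_outer M N W'"
  by (rule rectangle_outer_greatest) (rule rectangle_outer_le, auto)

lemma rectangle_outer_empty: "rectangle_outer M N {} = 0"
proof -
  have "rectangle_outer M N {} \<le> (\<Sum>i::nat. emeasure M {} * emeasure N {})"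
    by (rule rectangle_outer_le) auto
  then show ?thesis by simp
qed

lemma countably_subadditive_rectangle_outer:
  "countably_subadditive (Pow \<Omega>) (rectangle_outer M N)"
  unfolding countably_subadditive_def
proof (intro allI impI)
  fix A :: "nat \<Rightarrow> (_ \<times> _) set"
  show "rectangle_outer M N (\<Union>i. A i) \<le> (\<Sum>i. rectangle_outer M N (A i))"
  proof (cases "(\<Sum>i. rectangle_outer M N (A i)) = \<infinity>")
    case False
    then have fin: "rectangle_outer M N (A i) < \<infinity>" for i
      by (intro ennreal_suminf_lessD[where f = "\<lambda>i. rectangle_outer M N (A i)"]) (simp add: less_top)
    show ?thesis
    proof (rule ennreal_le_epsilon)
      fix e :: real assume e: "0 < e"
      have "\<exists>U V. range U \<subseteq> sets M \<and> range V \<subseteq> sets N \<and> A i \<subseteq> (\<Union>j. U j \<times> V j) \<and>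
          (\<Sum>j. emeasure M (U j) * emeasure N (V j)) < rectangle_outer M N (A i) + e * (1/2)^Suc i" for i
      proof -
        have "rectangle_outer M N (A i) + 0 < rectangle_outer M N (A i) + ennreal (e * (1/2)^Suc i)"
          using fin[of i] e by (subst ennreal_add_left_cancel_less) auto
        then have "rectangle_outer M N (A i) < rectangle_outer M N (A i) + ennreal (e * (1/2)^Suc i)"
          by simp
        then show ?thesis by (rule rectangle_outer_less) blast
      qed
      then have "\<forall>i. \<exists>U V. range U \<subseteq> sets M \<and> range V \<subseteq> sets N \<and> A i \<subseteq> (\<Union>j. U j \<times> V j) \<and>
          (\<Sum>j. emeasure M (U j) * emeasure N (V j)) < rectangle_outer M N (A i) + e * (1/2)^Suc i"
        by (intro allI)
      then obtain U V where U: "\<And>i. range (U i) \<subseteq> sets M" and V: "\<And>i. range (V i) \<subseteq> sets N"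
        and A: "\<And>i. A i \<subseteq> (\<Union>j. U i j \<times> V i j)"
        and le: "\<And>i. (\<Sum>j. emeasure M (U i j) * emeasure N (V i j))
                    < rectangle_outer M N (A i) + e * (1/2)^Suc i"
        unfolding choice_iff by (elim exE) (rule that, (drule spec, elim conjE, assumption)+)
      define U' where "U' = case_prod U \<circ> prod_decode"
      define V' where "V' = case_prod V \<circ> prod_decode"
      have "rectangle_outer M N (\<Union>i. A i) \<le> (\<Sum>k. emeasure M (U' k) * emeasure N (V' k))"
      proof (rule rectangle_outer_le)
        show "range U' \<subseteq> sets M" "range V' \<subseteq> sets N"
          using U V by (auto simp: U'_def V'_def split: prod.split)
        show "(\<Union>i. A i) \<subseteq> (\<Union>k. U' k \<times> V' k)"
        proof
          fix z assume "z \<in> (\<Union>i. A i)"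
          then obtain i j where "z \<in> U i j \<times> V i j" using A by blast
          then have "z \<in> U' (prod_encode (i, j)) \<times> V' (prod_encode (i, j))"
            by (simp add: U'_def V'_def)
          then show "z \<in> (\<Union>k. U' k \<times> V' k)" by blast
        qed
      qed
      also have "\<dots> = (\<Sum>k. (\<lambda>(i, j). emeasure M (U i j) * emeasure N (V i j)) (prod_decode k))"
        by (simp add: U'_def V'_def case_prod_beta)
      also have "\<dots> = (\<Sum>i. \<Sum>j. emeasure M (U i j) * emeasure N (V i j))"
        by (rule suminf_ennreal_2dimen) simp
      also have "\<dots> \<le> (\<Sum>i. rectangle_outer M N (A i) + ennreal (e * (1/2)^Suc i))"
        using le by (intro suminf_le) (auto intro: less_imp_le)
      also have "\<dots> = (\<Sum>i. rectangle_outer M N (A i)) + (\<Sum>i. ennreal (e * (1/2)^Suc i))"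
        by (subst suminf_add) auto
      also have "(\<Sum>i. ennreal (e * (1/2)^Suc i)) = ennreal e"
        using sums_mult[OF power_half_series, of e] e
        by (intro suminf_ennreal_eq) (auto simp: field_simps)
      finally show "rectangle_outer M N (\<Union>i. A i) \<le> (\<Sum>i. rectangle_outer M N (A i)) + ennreal e" .
    qed
  qed simp
qed

lemma outer_measure_space_rectangle_outer: "outer_measure_space (Pow \<Omega>) (rectangle_outer M N)"
  by (simp add: outer_measure_space_def positive_def increasing_def rectangle_outer_empty
      rectangle_outer_mono countably_subadditive_rectangle_outer)

lemma rectangle_outer_Un: "rectangle_outer M N (A \<union> B) \<le> rectangle_outer M N A + rectangle_outer M N B"
proof -
  have "subadditive UNIV (rectangle_outer M N)"
    using ring_of_sets.countably_subadditive_subadditive[of UNIV UNIV "rectangle_outer M N"]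
      countably_subadditive_rectangle_outer[of UNIV M N]
    by (simp add: positive_def rectangle_outer_empty ring_of_sets_iff)
  moreover have "A \<union> B = A \<union> (B - A)" by auto
  ultimately have "rectangle_outer M N (A \<union> B) \<le> rectangle_outer M N A + rectangle_outer M N (B - A)"
    unfolding subadditive_def by (metis Diff_disjoint UNIV_I)
  also have "\<dots> \<le> rectangle_outer M N A + rectangle_outer M N B"
    by (intro add_left_mono rectangle_outer_mono) auto
  finally show ?thesis .
qed

lemma rectangle_in_lambda_system:
  assumes a[measurable]: "a \<in> sets M" and b[measurable]: "b \<in> sets N"
  shows "a \<times> b \<in> lambda_system (space M \<times> space N) (Pow (space M \<times> space N)) (rectangle_outer M N)"
proof -
  have *: "rectangle_outer M N (X \<inter> (a \<times> b)) + rectangle_outer M N (X - a \<times> b) \<le> rectangle_outer M N X" for X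
  proof (rule rectangle_outer_greatest)
    fix U :: "nat \<Rightarrow> _ set" and V :: "nat \<Rightarrow> _ set"
    assume U: "range U \<subseteq> sets M" and V: "range V \<subseteq> sets N" and X: "X \<subseteq> (\<Union>i. U i \<times> V i)"
    have [measurable]: "U i \<in> sets M" "V i \<in> sets N" for i using U V by auto
    let ?m = "\<lambda>U V. \<Sum>i::nat. emeasure M (U i) * emeasure N (V i)"
    have 1: "rectangle_outer M N (X \<inter> (a \<times> b)) \<le> ?m (\<lambda>i. U i \<inter> a) (\<lambda>i. V i \<inter> b)"
      by (rule rectangle_outer_le) (use X in auto)
    have "rectangle_outer M N (X - a \<times> b)
        \<le> rectangle_outer M N (\<Union>i. (U i - a) \<times> V i) + rectangle_outer M N (\<Union>i. (U i \<inter> a) \<times> (V i - b))"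
      by (rule order_trans[OF rectangle_outer_mono rectangle_outer_Un]) (use X in blast)
    also have "\<dots> \<le> ?m (\<lambda>i. U i - a) V + ?m (\<lambda>i. U i \<inter> a) (\<lambda>i. V i - b)"
      by (intro add_mono rectangle_outer_le) auto
    finally have 2: "rectangle_outer M N (X - a \<times> b) \<le> \<dots>" .
    have "rectangle_outer M N (X \<inter> (a \<times> b)) + rectangle_outer M N (X - a \<times> b)
      \<le> ?m (\<lambda>i. U i \<inter> a) (\<lambda>i. V i \<inter> b) + (?m (\<lambda>i. U i - a) V + ?m (\<lambda>i. U i \<inter> a) (\<lambda>i. V i - b))"
      by (intro add_mono 1 2)
    also have "\<dots> = (\<Sum>i. emeasure M (U i \<inter> a) * emeasure N (V i \<inter> b) +
        (emeasure M (U i - a) * emeasure N (V i) + emeasure M (U i \<inter> a) * emeasure N (V i - b)))"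
      by (simp add: suminf_add)
    also have "\<dots> = ?m U V"
    proof (rule suminf_cong)
      fix i
      have u: "emeasure M (U i) = emeasure M (U i \<inter> a) + emeasure M (U i - a)"
        by (subst plus_emeasure) (auto intro!: arg_cong[where f = "emeasure M"])
      have v: "emeasure N (V i) = emeasure N (V i \<inter> b) + emeasure N (V i - b)"
        by (subst plus_emeasure) (auto intro!: arg_cong[where f = "emeasure N"])
      show "emeasure M (U i \<inter> a) * emeasure N (V i \<inter> b) +
        (emeasure M (U i - a) * emeasure N (V i) + emeasure M (U i \<inter> a) * emeasure N (V i - b))
        = emeasure M (U i) * emeasure N (V i)"
        by (simp add: u v distrib_left distrib_right ac_simps)
    qed
    finally show "rectangle_outer M N (X \<inter> (a \<times> b)) + rectangle_outer M N (X - a \<times> b) \<le> ?m U V" .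
  qed
  have "rectangle_outer M N X \<le> rectangle_outer M N (X \<inter> (a \<times> b)) + rectangle_outer M N (X - a \<times> b)" for X
    by (rule order_trans[OF rectangle_outer_mono rectangle_outer_Un]) auto
  with * have "rectangle_outer M N (X \<inter> (a \<times> b)) + rectangle_outer M N (X - a \<times> b) = rectangle_outer M N X" for X
    by (intro antisym)
  moreover have "a \<times> b \<subseteq> space M \<times> space N"
    using sets.sets_into_space[OF a] sets.sets_into_space[OF b] by auto
  moreover have "algebra (space M \<times> space N) (Pow (space M \<times> space N))"
    using sigma_algebra_Pow sigma_algebra_def by blast
  ultimately show ?thesis
    by (subst algebra.lambda_system_eq) auto
qed

lemma emeasure_maximal_product:
  assumes W: "W \<in> sets (M \<boxtimes>\<^sub>M N)"
  shows "emeasure (M \<boxtimes>\<^sub>M N) W = rectangle_outer M N W"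
proof -
  let ?O = "space M \<times> space N" and ?R = "{a \<times> b | a b. a \<in> sets M \<and> b \<in> sets N}"
  let ?L = "lambda_system ?O (Pow ?O) (rectangle_outer M N)"
  have L: "measure_space ?O ?L (rectangle_outer M N)"
    by (rule sigma_algebra.caratheodory_lemma[OF sigma_algebra_Pow outer_measure_space_rectangle_outer])
  then interpret L: sigma_algebra ?O ?L by (simp add: measure_space_def)
  have "sigma_sets ?O ?R \<subseteq> ?L"
    by (rule L.sigma_sets_subset) (use rectangle_in_lambda_system in auto)
  then have ms: "measure_space ?O (sigma_sets ?O ?R) (rectangle_outer M N)"
    by (intro measure_down[OF L] sigma_algebra_sigma_sets pair_measure_closed)
  have sets: "sets (M \<boxtimes>\<^sub>M N) = sigma_sets ?O ?R"
    by (simp add: sets_maximal_product sets_pair_measure)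
  show ?thesis
    by (rule emeasure_measure_of[OF maximal_product_def pair_measure_closed _ _ W])
       (use ms in \<open>simp_all add: sets measure_space_def\<close>)
qed

lemma rectangle_outer_Times:
  assumes a[measurable]: "a \<in> sets M" and b[measurable]: "b \<in> sets N"
  shows "rectangle_outer M N (a \<times> b) = emeasure M a * emeasure N b"
proof (rule antisym)
  have "rectangle_outer M N (a \<times> b)
      \<le> (\<Sum>i::nat. emeasure M (if i = 0 then a else {}) * emeasure N (if i = 0 then b else {}))"
    by (rule rectangle_outer_le) (auto split: if_splits)
  also have "\<dots> = emeasure M a * emeasure N b"
    by (subst suminf_finite[where N = "{0}"]) auto
  finally show "rectangle_outer M N (a \<times> b) \<le> emeasure M a * emeasure N b" .
next
  show "emeasure M a * emeasure N b \<le> rectangle_outer M N (a \<times> b)"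
  proof (rule rectangle_outer_greatest)
    fix U :: "nat \<Rightarrow> _ set" and V :: "nat \<Rightarrow> _ set"
    assume U: "range U \<subseteq> sets M" and V: "range V \<subseteq> sets N" and X: "a \<times> b \<subseteq> (\<Union>i. U i \<times> V i)"
    have [measurable]: "U i \<in> sets M" "V i \<in> sets N" for i using U V by auto
    have "emeasure M a * emeasure N b = (\<integral>\<^sup>+x. emeasure N b * indicator a x \<partial>M)"
      by (subst nn_integral_cmult_indicator) (auto simp: mult.commute)
    also have "\<dots> \<le> (\<integral>\<^sup>+x. (\<Sum>i. emeasure N (V i) * indicator (U i) x) \<partial>M)"
    proof (rule nn_integral_mono)
      fix x
      show "emeasure N b * indicator a x \<le> (\<Sum>i. emeasure N (V i) * indicator (U i) x)"
      proof (cases "x \<in> a")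
        case True
        have "emeasure N b \<le> emeasure N (\<Union>i. if x \<in> U i then V i else {})"
          by (rule emeasure_mono) (use X True in \<open>force+\<close>)
        also have "\<dots> \<le> (\<Sum>i. emeasure N (if x \<in> U i then V i else {}))"
          by (rule emeasure_subadditive_countably) auto
        also have "\<dots> = (\<Sum>i. emeasure N (V i) * indicator (U i) x)"
          by (rule suminf_cong) auto
        finally show ?thesis using True by simp
      qed simp
    qed
    also have "\<dots> = (\<Sum>i. emeasure M (U i) * emeasure N (V i))"
      by (simp add: nn_integral_suminf nn_integral_cmult_indicator mult.commute[of "emeasure M _"])
    finally show "emeasure M a * emeasure N b \<le> (\<Sum>i. emeasure M (U i) * emeasure N (V i))" .
  qed
qed

lemma is_product_measure_maximal_product: "is_product_measure M N (M \<boxtimes>\<^sub>M N)"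
  by (simp add: is_product_measure_def sets_maximal_product emeasure_maximal_product rectangle_outer_Times)


section \<open>The iterated-integral product of s-finite measures\<close>

lemma measurable_emeasure_Pair_s_finite:
  assumes N: "s_finite_measure N" and Q: "Q \<in> sets (M \<Otimes>\<^sub>M N)"
  shows "(\<lambda>x. emeasure N (Pair x -` Q)) \<in> borel_measurable M"
proof -
  obtain F :: "nat \<Rightarrow> 'a measure" where F: "\<And>i. sets (F i) = sets N" "\<And>i. finite_measure (F i)"
    and eq: "\<And>A. A \<in> sets N \<Longrightarrow> emeasure N A = (\<Sum>i. emeasure (F i) A)"
    using N unfolding s_finite_measure_def by blast
  have "(\<lambda>x. emeasure (F i) (Pair x -` Q)) \<in> borel_measurable M" for i
  proof -
    interpret finite_measure "F i" by (rule F)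
    have "Q \<in> sets (M \<Otimes>\<^sub>M F i)" using Q F(1)[of i] by (simp cong: sets_pair_measure_cong)
    then show ?thesis by (rule measurable_emeasure_Pair)
  qed
  then show ?thesis by (simp add: eq sets_Pair1[OF Q])
qed

lemma emeasure_pair_measure_s_finite:
  assumes N: "s_finite_measure N" and W: "W \<in> sets (M \<Otimes>\<^sub>M N)"
  shows "emeasure (M \<otimes>\<^sup>l N) W = (\<integral>\<^sup>+x. \<integral>\<^sup>+y. indicator W (x, y) \<partial>N \<partial>M)" (is "_ = ?\<mu> W")
proof (rule emeasure_measure_of[OF pair_measure_def pair_measure_closed _ _ W])
  show "positive (sets (M \<Otimes>\<^sub>M N)) ?\<mu>"
    by (auto simp: positive_def)
  have ind: "indicator A (x, y) = (indicator (Pair x -` A) y :: ennreal)" for A :: "('b \<times> 'a) set" and x y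
    by (auto simp: indicator_def)
  have \<mu>: "?\<mu> A = (\<integral>\<^sup>+x. emeasure N (Pair x -` A) \<partial>M)" if "A \<in> sets (M \<Otimes>\<^sub>M N)" for A
    using that by (simp add: ind sets_Pair1)
  show "countably_additive (sets (M \<Otimes>\<^sub>M N)) ?\<mu>"
  proof (rule countably_additiveI)
    fix F :: "nat \<Rightarrow> ('b \<times> 'a) set"
    assume F: "range F \<subseteq> sets (M \<Otimes>\<^sub>M N)" "disjoint_family F" and UF: "(\<Union>i. F i) \<in> sets (M \<Otimes>\<^sub>M N)"
    have Fi: "F i \<in> sets (M \<Otimes>\<^sub>M N)" for i using F by auto
    have "(\<Sum>i. ?\<mu> (F i)) = (\<integral>\<^sup>+x. (\<Sum>i. emeasure N (Pair x -` F i)) \<partial>M)"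
      using Fi by (simp add: \<mu> nn_integral_suminf measurable_emeasure_Pair_s_finite[OF N])
    also have "\<dots> = ?\<mu> (\<Union>i. F i)"
      unfolding \<mu>[OF UF] vimage_UN
    proof (rule nn_integral_cong)
      fix x
      show "(\<Sum>i. emeasure N (Pair x -` F i)) = emeasure N (\<Union>i. Pair x -` F i)"
        using Fi by (intro suminf_emeasure disjoint_family_on_bisimulation[OF F(2)]) (auto simp: sets_Pair1)
    qed
    finally show "(\<Sum>i. ?\<mu> (F i)) = ?\<mu> (\<Union>i. F i)" .
  qed
qed

lemma is_product_measure_pair_measure_s_finite:
  assumes N: "s_finite_measure N"
  shows "is_product_measure M N (M \<otimes>\<^sup>l N)"
  unfolding is_product_measure_def
proof (intro conjI ballI)
  fix U V assume [measurable]: "U \<in> sets M" "V \<in> sets N"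
  have "emeasure (M \<otimes>\<^sup>l N) (U \<times> V) = (\<integral>\<^sup>+x. \<integral>\<^sup>+y. indicator (U \<times> V) (x, y) \<partial>N \<partial>M)"
    by (rule emeasure_pair_measure_s_finite[OF N]) simp
  also have "\<dots> = (\<integral>\<^sup>+x. emeasure N V * indicator U x \<partial>M)"
    by (simp add: indicator_times nn_integral_cmult mult.commute[of "emeasure N V"])
  finally show "emeasure (M \<otimes>\<^sup>l N) (U \<times> V) = emeasure M U * emeasure N V"
    by (simp add: nn_integral_cmult_indicator mult.commute[of "emeasure M U"])
qed simp

end

theory Submission
  imports Defs
begin

text \<open>
  Take both factors to be \<open>\<infinity>\<close> times Lebesgue measure on the unit interval. Every section of the
  diagonal is a point, so the iterated integral of the diagonal is \<open>0\<close>. A rectangle of finite mass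
  has a null side; hence countably many such rectangles meet the diagonal only over a null set, and
  the maximal product gives the diagonal infinite mass.
\<close>

lemma suminf_const_ennreal: "(\<Sum>i::nat. c) = \<infinity> * (c::ennreal)"
proof (cases "c = 0")
  case False
  have "(\<Sum>i::nat. c) = c * (\<Sum>i::nat. 1)"
    using ennreal_suminf_cmult[of c "\<lambda>_. 1"] by simp
  \<comment> \<open>Summation over \<open>nat\<close> is integration against counting measure, so
    this sum of ones is the counting measure of an infinite set.\<close>
  also have "(\<Sum>i::nat. 1::ennreal) = emeasure (count_space UNIV) (UNIV :: nat set)"
    using nn_integral_count_space_nat[of "\<lambda>_. 1"] by simp
  finally show ?thesis using False by (simp add: ennreal_mult_top ennreal_top_mult)
qed simp

text \<open>Countably many copies of the finite measure \<open>M\<close> add up to \<infinity> times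
  \<open>M\<close>; on null sets this relies on \<open>\<infinity> * 0 = 0\<close>.\<close>

lemma s_finite_scale_measure_infinity:
  assumes "finite_measure M"
  shows "s_finite_measure (scale_measure \<infinity> M)"
  unfolding s_finite_measure_def
  by (rule exI[of _ "\<lambda>_. M"]) (use assms in \<open>simp add: suminf_const_ennreal\<close>)

lemma rectangle_outer_scale_infinity_diagonal:
  assumes "emeasure M (space M) \<noteq> 0"
  shows "rectangle_outer (scale_measure \<infinity> M) (scale_measure \<infinity> M) {(x, x) | x. x \<in> space M} \<noteq> 0"
    (is "rectangle_outer ?M ?M ?D \<noteq> 0")
proof
  assume "rectangle_outer ?M ?M ?D = 0"
  then have "rectangle_outer ?M ?M ?D < \<infinity>"
    by simp
  then obtain U V where U: "range U \<subseteq> sets M" and V: "range V \<subseteq> sets M"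
    and D: "?D \<subseteq> (\<Union>i. U i \<times> V i)"
    and fin: "(\<Sum>i. emeasure ?M (U i) * emeasure ?M (V i)) < \<infinity>"
    by (rule rectangle_outer_less) auto
  \<comment> \<open>\<open>U i \<inter> V i\<close> is the set of points over which the rectangle
    \<open>U i \<times> V i\<close> meets the diagonal.\<close>
  have null: "U i \<inter> V i \<in> null_sets M" for i
  proof -
    have meas: "U i \<in> sets M" "V i \<in> sets M"
      using U V by auto
    have "emeasure ?M (U i) * emeasure ?M (V i) < \<infinity>"
      using fin ennreal_suminf_lessD[of "\<lambda>i. emeasure ?M (U i) * emeasure ?M (V i)"] by simp
    \<comment> \<open>The scaled measure takes only the values 0 and \<infinity>, so a product of
      two of its values is finite only if one factor vanishes.\<close>
    then have "emeasure M (U i) = 0 \<or> emeasure M (V i) = 0"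
      by (auto simp: ennreal_mult_less_top ennreal_top_mult split: if_splits)
    then have "U i \<in> null_sets M \<or> V i \<in> null_sets M"
      using meas by auto
    then show ?thesis
      using meas null_set_Int1 null_set_Int2 by blast
  qed
  have "space M \<subseteq> (\<Union>i. U i \<inter> V i)"
    using D by auto
  moreover have "(\<Union>i. U i \<inter> V i) \<in> null_sets M"
    by (rule null_sets_UN) (rule null)
  ultimately have "space M \<in> null_sets M"
    by (rule null_sets_subset[rotated 2]) (rule sets.top)
  then show False
    using assms by (simp add: null_setsD1)
qed

lemma emeasure_iterated_product_diagonal:
  assumes "s_finite_measure N" "\<And>x. x \<in> space M \<Longrightarrow> emeasure N {x} = 0"
    and "{(x, x) | x. x \<in> space M} \<in> sets (M \<Otimes>\<^sub>M N)"
  shows "emeasure (M \<otimes>\<^sup>l N) {(x, x) | x. x \<in> space M} = 0"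
proof -
  have "(\<integral>\<^sup>+y. indicator {(x, x) | x. x \<in> space M} (x, y) \<partial>N) = 0" if "x \<in> space M" for x
  proof -
    have "Pair x -` {(x, x) | x. x \<in> space M} = {x}"
      using that by auto
    \<comment> \<open>Being a section of the measurable diagonal makes the point measurable. This is
      not implied by \<open>emeasure N {x} = 0\<close>, since \<open>emeasure\<close> is 0 by
      default outside \<open>sets N\<close>.\<close>
    then have "{x} \<in> sets N"
      using sets_Pair1[OF assms(3), of x] by simp
    moreover have "(\<lambda>y. indicator {(x, x) | x. x \<in> space M} (x, y)) = (indicator {x} :: _ \<Rightarrow> ennreal)"
      using that by (auto simp: fun_eq_iff indicator_def)
    ultimately show ?thesis
      using assms(2)[OF that] by simp
  qed
  then show ?thesis
    by (simp add: emeasure_pair_measure_s_finite[OF assms(1,3)] cong: nn_integral_cong)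
qed

theorem theorem3:
  shows "(\<exists>(\<mu> :: real measure) (\<nu> :: real measure).
            s_finite_measure \<mu> \<and> s_finite_measure \<nu> \<and>
            (\<exists>P Q. is_product_measure \<mu> \<nu> P \<and> is_product_measure \<mu> \<nu> Q \<and> P \<noteq> Q)) \<and>
         (\<exists>(\<mu> :: real measure) (\<nu> :: real measure).
            s_finite_measure \<mu> \<and> s_finite_measure \<nu> \<and> \<mu> \<otimes>\<^sup>l \<nu> \<noteq> \<mu> \<boxtimes>\<^sub>M \<nu>)"
proof -
  \<comment> \<open>As \<open>{0..1}\<close> has Lebesgue measure 1, the normalisation changes
    nothing: \<open>L\<close> is Lebesgue measure cut down to the unit interval, still living on all
    of \<open>real\<close>.\<close>
  define L :: "real measure" where "L = uniform_measure lborel {0..1}"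
  define \<mu> where "\<mu> = scale_measure \<infinity> L"
  have L: "emeasure L A = emeasure lborel ({0..1} \<inter> A)" if "A \<in> sets borel" for A
    unfolding L_def using that by (subst emeasure_uniform_measure) (simp_all add: divide_ennreal_def)
  have space [simp]: "space L = UNIV" "space \<mu> = UNIV"
    by (simp_all add: L_def \<mu>_def space_scale_measure)
  have sets [measurable_cong, simp]: "sets \<mu> = sets borel"
    by (simp add: L_def \<mu>_def)
  have "finite_measure L"
    by (rule finite_measureI) (simp add: L)
  then have s_finite: "s_finite_measure \<mu>"
    unfolding \<mu>_def by (rule s_finite_scale_measure_infinity)
  let ?D = "{(x, x) | x. x \<in> (UNIV :: real set)}"
  \<comment> \<open>The diagonal is measurable as the set where two real-valued measurable
    functions, the coordinate projections, agree.\<close>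
  have "{z \<in> space (\<mu> \<Otimes>\<^sub>M \<mu>). fst z = snd z} \<in> sets (\<mu> \<Otimes>\<^sub>M \<mu>)"
    by measurable
  also have "{z \<in> space (\<mu> \<Otimes>\<^sub>M \<mu>). fst z = snd z} = ?D"
    by (auto simp: space_pair_measure)
  finally have D: "?D \<in> sets (\<mu> \<Otimes>\<^sub>M \<mu>)" .
  have "emeasure L {x} = 0" for x
    using emeasure_mono[of "{0..1} \<inter> {x}" "{x}" lborel] by (simp add: L)
  then have "emeasure \<mu> {x} = 0" for x
    by (simp add: \<mu>_def)
  then have "emeasure (\<mu> \<otimes>\<^sup>l \<mu>) ?D = 0"
    using emeasure_iterated_product_diagonal[OF s_finite, of \<mu>] D
    by simp
  moreover have "emeasure (\<mu> \<boxtimes>\<^sub>M \<mu>) ?D \<noteq> 0"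
    using rectangle_outer_scale_infinity_diagonal[of L, folded \<mu>_def] D
    by (simp add: emeasure_maximal_product sets_maximal_product L del: sets)
  ultimately have "\<mu> \<otimes>\<^sup>l \<mu> \<noteq> \<mu> \<boxtimes>\<^sub>M \<mu>"
    by metis
  then show ?thesis
    \<comment> \<open>The pair \<open>\<mu>\<close>, \<open>\<mu>\<close> serves both claims: its
      two distinct products are both product measures.\<close>
    using s_finite is_product_measure_maximal_product is_product_measure_pair_measure_s_finite by blast
qed

end
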